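(* Let $G$ be a topological group. Then $(SP)\cap(QP)\subseteq(P)$; that is, every continuous function $f:G\to\mathbb{C}$ that is both a semipolynomial and a quasipolynomial on $G$ is a polynomial on $G$.
   Context: $C(G)$ is the space of continuous functions $f:G\to\mathbb{C}$. For $h\in G$, $(R_hf)(x)=f(xh)$ and $\Delta_h=R_h-1$. $(P_n)$ is the set of $f\in C(G)$ with $\Delta_{h_{n+1}}\cdots\Delta_{h_1}f=0$ for all $h_1,\dots,h_{n+1}\in G$, and $(SP_n)$ is the set of $f\in C(G)$ with $\Delta_h^{n+1}f=0$ for all $h\in G$. $(P)=\bigcup_{n\ge0}(P_n)$ (polynomials), $(SP)=\bigcup_{n\ge0}(SP_n)$ (semipolynomials). $(QP)$ is the set of quasipolynomials: those $f\in C(G)$ for which the linear span of $\{R_hf:h\in G\}$ is finite-dimensional. *)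

theory Defs
  imports "HOL-Analysis.Analysis" "HOL-Library.Function_Algebras"
begin

text \<open>
  The group \<open>G\<close> is a type of class \<^class>\<open>topological_group_add\<close>: the group law is written \<open>+\<close>
  but is not assumed commutative, and no separation axiom is assumed of the topology.
  Thus \<open>x + h\<close> stands for the product \<open>xh\<close>.
  The zero, sum and difference of functions are pointwise, as in \<open>HOL-Library.Function_Algebras\<close>.
\<close>

definition cfun_scale :: "complex \<Rightarrow> ('g \<Rightarrow> complex) \<Rightarrow> 'g \<Rightarrow> complex" where
  "cfun_scale c f = (\<lambda>x. c * f x)"

global_interpretation cfun: vector_space "cfun_scale :: complex \<Rightarrow> ('g \<Rightarrow> complex) \<Rightarrow> 'g \<Rightarrow> complex"
  by unfold_locales (auto simp: cfun_scale_def algebra_simps)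

definition right_shift :: "'g::topological_group_add \<Rightarrow> ('g \<Rightarrow> complex) \<Rightarrow> 'g \<Rightarrow> complex" where
  "right_shift h f = (\<lambda>x. f (x + h))"

definition diff_op :: "'g::topological_group_add \<Rightarrow> ('g \<Rightarrow> complex) \<Rightarrow> 'g \<Rightarrow> complex" where
  "diff_op h f = right_shift h f - f"

text \<open>The list \<open>hs\<close> is \<open>[h\<^sub>1, \<dots>, h\<^sub>n\<^sub>+\<^sub>1]\<close>; \<^const>\<open>fold\<close> applies the operator for \<open>h\<^sub>1\<close> first.\<close>

definition polynomials_deg :: "nat \<Rightarrow> ('g::topological_group_add \<Rightarrow> complex) set" where
  "polynomials_deg n =
    {f. continuous_on UNIV f \<and> (\<forall>hs. length hs = n + 1 \<longrightarrow> fold diff_op hs f = 0)}"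

definition semipolynomials_deg :: "nat \<Rightarrow> ('g::topological_group_add \<Rightarrow> complex) set" where
  "semipolynomials_deg n =
    {f. continuous_on UNIV f \<and> (\<forall>h. (diff_op h ^^ (n + 1)) f = 0)}"

definition polynomials :: "('g::topological_group_add \<Rightarrow> complex) set" where
  "polynomials = (\<Union>n. polynomials_deg n)"

definition semipolynomials :: "('g::topological_group_add \<Rightarrow> complex) set" where
  "semipolynomials = (\<Union>n. semipolynomials_deg n)"

text \<open>A complex subspace is finite-dimensional iff it is the span of a finite set;
  \<open>cfun.dim\<close> is unsuitable here because it is \<open>0\<close> on infinite-dimensional spaces.\<close>

definition quasipolynomials :: "('g::topological_group_add \<Rightarrow> complex) set" where
  "quasipolynomials =
    {f. continuous_on UNIV f \<and>
        (\<exists>B. finite B \<and> cfun.span (range (\<lambda>h. right_shift h f)) = cfun.span B)}"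

end

theory Submission
  imports Defs "Jordan_Normal_Form.Schur_Decomposition"
begin

text \<open>
  On the span \<open>V\<close> of the translates of \<open>f\<close> every \<open>R\<^sub>h\<close> is unipotent, because \<open>\<Delta>\<^sub>h\<close> and \<open>R\<^sub>g\<close> commute up to
  conjugating \<open>h\<close>. This is the setting of Kolchin's theorem. Linear combinations of the \<open>\<Delta>\<^sub>g\<close> on \<open>V\<close> are
  closed under composition, and each \<open>\<Delta>\<^sub>g\<close> has trace \<open>0\<close>; so if \<open>A\<close> is such a combination, all its powers
  have trace \<open>0\<close> and \<open>1\<close> is not an eigenvalue of \<open>A\<close>. Hence a nonzero \<open>w \<in> V\<close> never lies in the
  span of the \<open>\<Delta>\<^sub>g w\<close>. That span contains all further differences of \<open>w\<close>, so as long as they do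
  not vanish, the iterated differences of \<open>f\<close> are linearly independent, and at most \<open>dim V\<close> of them
  can be nonzero.
\<close>

unbundle no vec_syntax and no inner_syntax

section \<open>Matrices: traces of powers as power sums of eigenvalues\<close>

definition diag_sum :: "'a::comm_monoid_add mat \<Rightarrow> 'a" where
  "diag_sum A = (\<Sum>i<dim_row A. A $$ (i, i))"

lemma diag_sum_mult_commute:
  fixes A B :: "'a::comm_ring_1 mat"
  assumes "A \<in> carrier_mat n n" "B \<in> carrier_mat n n"
  shows "diag_sum (A * B) = diag_sum (B * A)"
proof -
  have "diag_sum (A * B) = (\<Sum>i<n. \<Sum>k<n. A $$ (i, k) * B $$ (k, i))"
    using assms by (simp add: diag_sum_def scalar_prod_def atLeast0LessThan)
  also have "\<dots> = (\<Sum>k<n. \<Sum>i<n. B $$ (k, i) * A $$ (i, k))"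
    by (subst sum.swap) (simp add: mult.commute)
  also have "\<dots> = diag_sum (B * A)"
    using assms by (simp add: diag_sum_def scalar_prod_def atLeast0LessThan)
  finally show ?thesis .
qed

lemma upper_triangular_pow:
  fixes B :: "'a::comm_ring_1 mat"
  assumes B: "B \<in> carrier_mat n n" and ut: "upper_triangular B"
  shows "upper_triangular (B ^\<^sub>m k) \<and> (\<forall>i<n. (B ^\<^sub>m k) $$ (i, i) = (B $$ (i, i)) ^ k)"
proof (induction k)
  case 0
  then show ?case using B by auto
next
  case (Suc k)
  have C: "B ^\<^sub>m k \<in> carrier_mat n n" using B by simp
  have entry: "(B ^\<^sub>m k * B) $$ (i, j) = (\<Sum>l<n. (B ^\<^sub>m k) $$ (i, l) * B $$ (l, j))"
    if "i < n" "j < n" for i j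
    using that B C by (simp add: scalar_prod_def atLeast0LessThan)
  have zero: "(B ^\<^sub>m k) $$ (i, l) * B $$ (l, j) = 0" if "i < n" "l < n" "l < i \<or> j < l" for i j l
    using that Suc.IH ut B C by (auto simp: upper_triangular_def)
  have "(B ^\<^sub>m k * B) $$ (i, j) = 0" if "j < i" "i < n" for i j
  proof -
    have "(B ^\<^sub>m k * B) $$ (i, j) = (\<Sum>l<n. (B ^\<^sub>m k) $$ (i, l) * B $$ (l, j))"
      using that by (intro entry) auto
    also have "\<dots> = 0"
      using that by (intro sum.neutral ballI zero) auto
    finally show ?thesis .
  qed
  moreover have "(B ^\<^sub>m k * B) $$ (i, i) = (B $$ (i, i)) ^ Suc k" if i: "i < n" for i
  proof -
    have "(B ^\<^sub>m k * B) $$ (i, i) = (\<Sum>l\<in>{i}. (B ^\<^sub>m k) $$ (i, l) * B $$ (l, i))"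
      unfolding entry[OF i i] using i zero
      by (intro sum.mono_neutral_right) (auto simp: neq_iff)
    then show ?thesis using Suc.IH i by (simp add: mult.commute)
  qed
  ultimately show ?case
    using B by (auto simp: upper_triangular_def)
qed

text \<open>By Schur decomposition \<open>A\<close> is similar to an upper triangular matrix whose
  diagonal \<open>es\<close> lists the roots of the characteristic polynomial with multiplicity.
  Powers of \<open>A\<close> are similar to powers of the triangular matrix, and similarity
  preserves the trace.\<close>

lemma diag_sum_pow_eigenvalues:
  fixes A :: "complex mat"
  assumes A: "A \<in> carrier_mat n n"
  obtains es where "\<And>k. diag_sum (A ^\<^sub>m k) = (\<Sum>e\<leftarrow>es. e ^ k)"
    and "\<And>e. eigenvalue A e \<longleftrightarrow> e \<in> set es"
proof -
  obtain es where es: "char_poly A = (\<Prod>a\<leftarrow>es. [:- a, 1:])"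
    using char_poly_factorized[OF A] by blast
  obtain B P Q where schur: "schur_decomposition A es = (B, P, Q)"
    by (cases "schur_decomposition A es") auto
  have wit: "similar_mat_wit A B P Q" and ut: "upper_triangular B" and diag: "diag_mat B = es"
    using schur_decomposition[OF A es schur] by auto
  note w = similar_mat_witD2[OF A wit]
  have "diag_sum (A ^\<^sub>m k) = (\<Sum>e\<leftarrow>es. e ^ k)" for k
  proof -
    have "diag_sum (A ^\<^sub>m k) = diag_sum (P * (B ^\<^sub>m k * Q))"
      using w similar_mat_wit_pow_id[OF wit, of k] by (simp add: assoc_mult_mat[of _ n n _ n _ n])
    also have "\<dots> = diag_sum (B ^\<^sub>m k * Q * P)"
      using w by (intro diag_sum_mult_commute[of _ n]) auto
    also have "\<dots> = diag_sum (B ^\<^sub>m k)"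
      using w by (simp add: assoc_mult_mat[of _ n n _ n _ n])
    also have "\<dots> = (\<Sum>i<n. (B $$ (i, i)) ^ k)"
      using upper_triangular_pow[OF \<open>B \<in> carrier_mat n n\<close> ut, of k] w(5) by (simp add: diag_sum_def)
    also have "\<dots> = (\<Sum>e\<leftarrow>es. e ^ k)"
      using w(5) by (simp add: diag[symmetric] diag_mat_def o_def interv_sum_list_conv_sum_set_nat
          atLeast0LessThan)
    finally show ?thesis .
  qed
  moreover have "eigenvalue A e \<longleftrightarrow> e \<in> set es" for e
    unfolding eigenvalue_root_char_poly[OF A] es
    by (auto simp: poly_prod_list prod_list_zero_iff)
  ultimately show thesis by (rule that)
qed

text \<open>If \<open>1\<close> occurred, take a polynomial \<open>p\<close> that vanishes at
  \<open>0\<close> and at every other entry of \<open>es\<close>, but not at \<open>1\<close>.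
  Having no constant term, \<open>p\<close> sums to \<open>0\<close> over \<open>es\<close> by the
  hypothesis on exponents \<open>k \<ge> 1\<close>; yet the sum is the multiplicity of
  \<open>1\<close> times \<open>p(1)\<close>, which is nonzero in characteristic
  \<open>0\<close>.\<close>

lemma one_notin_if_power_sums_eq_0:
  fixes es :: "'a::field_char_0 list"
  assumes power_sums: "\<And>k. k \<ge> 1 \<Longrightarrow> (\<Sum>e\<leftarrow>es. e ^ k) = 0"
  shows "1 \<notin> set es"
proof
  assume "1 \<in> set es"
  define q :: "'a poly" where "q = (\<Prod>a\<in>set es - {1}. [:- a, 1:])"
  define p where "p = [:0, 1:] * q"
  have p1: "poly p 1 \<noteq> 0"
    by (simp add: p_def q_def poly_prod)
  have p_other: "poly p e = 0" if "e \<in> set es" "e \<noteq> 1" for e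
    using that by (simp add: p_def q_def poly_prod)
  have "(\<Sum>e\<leftarrow>es. poly p e) = (\<Sum>e\<leftarrow>es. \<Sum>i\<le>degree p. coeff p i * e ^ i)"
    by (simp add: poly_altdef)
  also have "\<dots> = (\<Sum>i\<le>degree p. coeff p i * (\<Sum>e\<leftarrow>es. e ^ i))"
    by (induction es) (simp_all add: sum.distrib algebra_simps)
  also have "\<dots> = 0"
  proof (intro sum.neutral ballI)
    fix i
    show "coeff p i * (\<Sum>e\<leftarrow>es. e ^ i) = 0"
      using power_sums[of i] by (cases i) (auto simp: p_def)
  qed
  finally have "(\<Sum>e\<leftarrow>es. poly p e) = 0" .
  moreover have "(\<Sum>e\<leftarrow>es. poly p e) = of_nat (count_list es 1) * poly p 1"
    using p_other by (induction es) (auto simp: algebra_simps)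
  ultimately show False
    using p1 \<open>1 \<in> set es\<close> by (simp add: count_list_0_iff)
qed

section \<open>Coordinates, matrices and traces on the span of a finite basis\<close>

locale vector_space_basis = vector_space scale
  for scale :: "'a::field \<Rightarrow> 'b::ab_group_add \<Rightarrow> 'b" (infixr \<open>*b\<close> 75) +
  fixes bs :: "'b list"
  assumes distinct_basis: "distinct bs" and independent_basis: "independent (set bs)"
begin

abbreviation coord :: "'b \<Rightarrow> 'b \<Rightarrow> 'a" where
  "coord \<equiv> representation (set bs)"

definition coords :: "'b \<Rightarrow> 'a Matrix.vec" where
  "coords v = Matrix.vec (length bs) (\<lambda>i. coord v (bs ! i))"

definition op_mat :: "('b \<Rightarrow> 'b) \<Rightarrow> 'a mat" where
  "op_mat T = Matrix.mat (length bs) (length bs) (\<lambda>(i, j). coord (T (bs ! j)) (bs ! i))"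

definition op_trace :: "('b \<Rightarrow> 'b) \<Rightarrow> 'a" where
  "op_trace T = (\<Sum>b\<in>set bs. coord (T b) b)"

text \<open>Operators are linear on the whole ambient space and leave the span of the basis
  invariant: a translation acts on all functions, but only its restriction to the span enters
  \<open>op_mat\<close> and \<open>op_trace\<close>.\<close>

definition endo :: "('b \<Rightarrow> 'b) \<Rightarrow> bool" where
  "endo T \<longleftrightarrow> Modules.module_hom scale scale T \<and> T ` span (set bs) \<subseteq> span (set bs)"

lemma endo_iff:
  "endo T \<longleftrightarrow> (\<forall>u v. T (u + v) = T u + T v) \<and> (\<forall>c v. T (c *b v) = c *b T v) \<and>
    (\<forall>v\<in>span (set bs). T v \<in> span (set bs))"
  by (auto simp: endo_def Modules.module_hom_iff module_axioms)

lemma endo_in_span: "endo T \<Longrightarrow> v \<in> span (set bs) \<Longrightarrow> T v \<in> span (set bs)"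
  by (auto simp: endo_def)

lemma endo_comp: "endo T \<Longrightarrow> endo U \<Longrightarrow> endo (T \<circ> U)"
  by (auto simp: endo_def intro: Modules.module_hom_compose)

lemma endo_id: "endo id"
  by (simp add: endo_iff)

lemma endo_funpow: "endo T \<Longrightarrow> endo (T ^^ k)"
  by (induction k) (simp_all add: endo_id endo_comp del: comp_apply)

lemma op_mat_carrier [simp]: "op_mat T \<in> carrier_mat (length bs) (length bs)"
  by (simp add: op_mat_def)

lemma coords_carrier [simp]: "coords v \<in> carrier_vec (length bs)"
  by (simp add: coords_def)

lemma diag_sum_op_mat: "diag_sum (op_mat T) = op_trace T"
proof -
  have "op_trace T = (\<Sum>b\<leftarrow>bs. coord (T b) b)"
    using distinct_basis by (simp add: op_trace_def sum_list_distinct_conv_sum_set)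
  then show ?thesis
    by (simp add: diag_sum_def op_mat_def sum_list_sum_nth atLeast0LessThan)
qed

lemma coords_eq_0_iff:
  assumes "v \<in> span (set bs)"
  shows "coords v = 0\<^sub>v (length bs) \<longleftrightarrow> v = 0"
proof
  assume zero: "coords v = 0\<^sub>v (length bs)"
  have "coord v (bs ! i) = 0" if "i < length bs" for i
    using that arg_cong[OF zero, of "\<lambda>u. u $ i"] by (simp add: coords_def)
  then have "coord v b = 0" if "b \<in> set bs" for b
    using that by (auto simp: in_set_conv_nth)
  then show "v = 0"
    using sum_representation_eq[OF independent_basis assms, of "set bs"] by simp
qed (auto simp: coords_def representation_zero)

lemma op_mat_mult_coords:
  assumes T: "endo T" and v: "v \<in> span (set bs)"
  shows "op_mat T *\<^sub>v coords v = coords (T v)"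
proof (rule eq_vecI)
  interpret T: Modules.module_hom scale scale T using T by (simp add: endo_def)
  fix i assume "i < dim_vec (coords (T v))"
  then have i: "i < length bs" by (simp add: coords_def)
  have TB: "T b \<in> span (set bs)" if "b \<in> set bs" for b
    using T that by (auto intro: span_base endo_in_span)
  have "T v = (\<Sum>b\<in>set bs. coord v b *b T b)"
    using arg_cong[OF sum_representation_eq[OF independent_basis v, of "set bs"], of T]
    by (simp add: T.sum T.scale)
  then have "coord (T v) (bs ! i) = (\<Sum>b\<in>set bs. coord v b * coord (T b) (bs ! i))"
    using TB by (simp add: representation_sum[OF independent_basis]
        representation_scale[OF independent_basis] span_scale)
  also have "\<dots> = (\<Sum>b\<leftarrow>bs. coord v b * coord (T b) (bs ! i))"
    using distinct_basis by (simp add: sum_list_distinct_conv_sum_set)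
  also have "\<dots> = (op_mat T *\<^sub>v coords v) $ i"
    using i by (simp add: op_mat_def coords_def scalar_prod_def sum_list_sum_nth mult.commute)
  finally show "(op_mat T *\<^sub>v coords v) $ i = coords (T v) $ i"
    using i by (simp add: coords_def)
qed (simp add: op_mat_def coords_def)

lemma op_mat_comp:
  assumes T: "endo T" and U: "endo U"
  shows "op_mat (T \<circ> U) = op_mat T * op_mat U"
proof (rule eq_matI)
  fix i j
  assume "i < dim_row (op_mat T * op_mat U)" "j < dim_col (op_mat T * op_mat U)"
  then have i: "i < length bs" and j: "j < length bs" by (simp_all add: op_mat_def)
  have "col (op_mat U) j = coords (U (bs ! j))"
    using j by (auto simp: op_mat_def coords_def)
  then have "(op_mat T * op_mat U) $$ (i, j) = (op_mat T *\<^sub>v coords (U (bs ! j))) $ i"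
    using i j by (simp add: op_mat_def)
  also have "\<dots> = coords (T (U (bs ! j))) $ i"
    using U j by (simp add: op_mat_mult_coords[OF T] endo_in_span span_base)
  also have "\<dots> = op_mat (T \<circ> U) $$ (i, j)"
    using i j by (simp add: op_mat_def coords_def)
  finally show "op_mat (T \<circ> U) $$ (i, j) = (op_mat T * op_mat U) $$ (i, j)" by simp
qed (simp_all add: op_mat_def)

lemma op_mat_funpow:
  assumes T: "endo T"
  shows "op_mat (T ^^ k) = op_mat T ^\<^sub>m k"
proof (induction k)
  case 0
  show ?case
    using distinct_basis independent_basis
    by (auto simp: op_mat_def representation_basis nth_eq_iff_index_eq)
next
  case (Suc k)
  then show ?case
    unfolding funpow_Suc_right using op_mat_comp[OF endo_funpow[OF T] T] by (simp add: o_def)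
qed

lemma op_trace_diff:
  assumes "endo T" "endo U"
  shows "op_trace (\<lambda>v. T v - U v) = op_trace T - op_trace U"
  using assms
  by (simp add: op_trace_def representation_diff[OF independent_basis] endo_in_span span_base
      sum_subtractf)

lemma op_trace_sum_scale:
  assumes "\<And>i. i \<in> I \<Longrightarrow> endo (T i)"
  shows "op_trace (\<lambda>v. \<Sum>i\<in>I. c i *b T i v) = (\<Sum>i\<in>I. c i * op_trace (T i))"
proof -
  have "op_trace (\<lambda>v. \<Sum>i\<in>I. c i *b T i v) = (\<Sum>b\<in>set bs. \<Sum>i\<in>I. c i * coord (T i b) b)"
    using assms
    by (simp add: op_trace_def representation_sum[OF independent_basis]
        representation_scale[OF independent_basis] endo_in_span span_base span_scale)
  also have "\<dots> = (\<Sum>i\<in>I. c i * op_trace (T i))"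
    by (subst sum.swap) (simp add: op_trace_def sum_distrib_left)
  finally show ?thesis .
qed

lemma endo_diff: "endo T \<Longrightarrow> endo U \<Longrightarrow> endo (\<lambda>v. T v - U v)"
  by (simp add: endo_iff span_diff scale_right_diff_distrib)

lemma endo_sum_scale:
  assumes "\<And>i. i \<in> I \<Longrightarrow> endo (T i)"
  shows "endo (\<lambda>v. \<Sum>i\<in>I. c i *b T i v)"
  using assms
  by (auto simp: endo_iff scale_right_distrib sum.distrib scale_sum_right mult.commute
      intro!: span_sum span_scale)

end

section \<open>Eigenvalues and traces of operators over the complex numbers\<close>

locale complex_vector_space_basis = vector_space_basis scale bs
  for scale :: "complex \<Rightarrow> 'b::ab_group_add \<Rightarrow> 'b" (infixr \<open>*b\<close> 75) and bs
begin

text \<open>Coordinates identify the span with column vectors and \<open>T\<close> with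
  \<open>op_mat T\<close>, so both claims transfer from matrices.\<close>

lemma op_trace_funpow_eigenvalues:
  assumes T: "endo T"
  obtains es where "\<And>k. op_trace (T ^^ k) = (\<Sum>e\<leftarrow>es. e ^ k)"
    and "\<And>e. e \<in> set es \<longleftrightarrow> (\<exists>v\<in>span (set bs). v \<noteq> 0 \<and> T v = e *b v)"
proof -
  let ?A = "op_mat T" and ?n = "length bs"
  obtain es where pow: "\<And>k. diag_sum (?A ^\<^sub>m k) = (\<Sum>e\<leftarrow>es. e ^ k)"
    and ev: "\<And>e. eigenvalue ?A e \<longleftrightarrow> e \<in> set es"
    using diag_sum_pow_eigenvalues[OF op_mat_carrier] by blast
  have scale_coords: "coords (e *b v) = e \<cdot>\<^sub>v coords v" if "v \<in> span (set bs)" for e v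
    using that by (auto simp: coords_def representation_scale[OF independent_basis])
  have eigenvector: "e \<in> set es" if v: "v \<in> span (set bs)" "v \<noteq> 0" "T v = e *b v" for v e
  proof -
    from v have "?A *\<^sub>v coords v = e \<cdot>\<^sub>v coords v"
      by (simp add: op_mat_mult_coords[OF T] scale_coords)
    then have "eigenvector ?A (coords v) e"
      using v by (simp add: eigenvector_def coords_eq_0_iff carrier_matD(1)[OF op_mat_carrier])
    then show ?thesis
      using ev by (auto simp: eigenvalue_def)
  qed
  have "e \<in> set es \<longleftrightarrow> (\<exists>v\<in>span (set bs). v \<noteq> 0 \<and> T v = e *b v)" for e
  proof
    assume "e \<in> set es"
    then obtain u where u: "u \<in> carrier_vec ?n" "u \<noteq> 0\<^sub>v ?n" "?A *\<^sub>v u = e \<cdot>\<^sub>v u"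
      using ev[of e] by (auto simp: eigenvalue_def eigenvector_def carrier_matD(1)[OF op_mat_carrier])
    \<comment> \<open>The eigenvector \<open>u\<close> of the matrix is turned back into the element
      of the span with coordinates \<open>u\<close>.\<close>
    define v where "v = (\<Sum>i<?n. u $ i *b bs ! i)"
    have v: "v \<in> span (set bs)"
      unfolding v_def by (intro span_sum span_scale span_base) simp
    have "coord v (bs ! i) = u $ i" if "i < ?n" for i
    proof -
      have "coord v (bs ! i) = (\<Sum>j<?n. u $ j * coord (bs ! j) (bs ! i))"
        unfolding v_def
        by (subst representation_sum[OF independent_basis])
          (simp_all add: representation_scale[OF independent_basis] span_base span_scale)
      also have "\<dots> = (\<Sum>j<?n. if j = i then u $ j else 0)"
        using that distinct_basis independent_basis
        by (intro sum.cong) (auto simp: representation_basis nth_eq_iff_index_eq)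
      finally show ?thesis using that by simp
    qed
    then have cv: "coords v = u"
      using u(1) by (auto simp: coords_def)
    \<comment> \<open>Coordinates determine elements of the span, so it is enough that those of the
      difference vanish.\<close>
    have "coords (T v - e *b v) = coords (T v) - coords (e *b v)"
      using v T
      by (auto simp: coords_def representation_diff[OF independent_basis] endo_in_span span_scale)
    also have "\<dots> = 0\<^sub>v ?n"
      using u(1) by (simp add: op_mat_mult_coords[OF T v, symmetric] scale_coords[OF v] cv u(3))
    finally have "T v = e *b v"
      using coords_eq_0_iff[of "T v - e *b v"] v T by (simp add: endo_in_span span_diff span_scale)
    moreover have "v \<noteq> 0"
      using u(2) cv coords_eq_0_iff[OF v] by simp
    ultimately show "\<exists>v\<in>span (set bs). v \<noteq> 0 \<and> T v = e *b v"
      using v by (intro bexI[of _ v] conjI)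
  qed (auto intro: eigenvector)
  moreover have "op_trace (T ^^ k) = (\<Sum>e\<leftarrow>es. e ^ k)" for k
    by (simp add: pow[symmetric] op_mat_funpow[OF T, symmetric] diag_sum_op_mat)
  ultimately show thesis
    by (intro that)
qed

text \<open>An eigenvector \<open>v\<close> for \<open>e\<close> is multiplied by
  \<open>e ^ m\<close> under the \<open>m\<close>-th power, so every eigenvalue is \<open>0\<close>,
  and the trace is the sum of the eigenvalues.\<close>

lemma op_trace_nilpotent:
  assumes T: "endo T" and nilpotent: "\<And>v. v \<in> span (set bs) \<Longrightarrow> (T ^^ m) v = 0"
  shows "op_trace T = 0"
proof -
  interpret T: Modules.module_hom scale scale T using T by (simp add: endo_def)
  obtain es where es: "\<And>k. op_trace (T ^^ k) = (\<Sum>e\<leftarrow>es. e ^ k)"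
    "\<And>e. e \<in> set es \<longleftrightarrow> (\<exists>v\<in>span (set bs). v \<noteq> 0 \<and> T v = e *b v)"
    by (rule op_trace_funpow_eigenvalues[OF T]) (rule that)
  have "e = 0" if e: "e \<in> set es" for e
  proof -
    obtain v where v: "v \<in> span (set bs)" "v \<noteq> 0" "T v = e *b v"
      using es(2)[of e] e by blast
    have "(T ^^ k) v = (e ^ k) *b v" for k
      by (induction k) (simp_all add: T.scale v(3) mult.commute)
    then show "e = 0"
      using nilpotent[OF v(1)] v(2) by simp
  qed
  then have "(\<Sum>e\<leftarrow>es. e) = 0"
    by (induction es) auto
  then show ?thesis
    using es(1)[of 1] by simp
qed

text \<open>A nonzero fixed vector would make \<open>1\<close> an eigenvalue, while the traces of
  the powers are the power sums of the eigenvalues.\<close>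

lemma fixed_vector_eq_0:
  assumes T: "endo T" and traces: "\<And>k. k \<ge> 1 \<Longrightarrow> op_trace (T ^^ k) = 0"
    and v: "v \<in> span (set bs)" "T v = v"
  shows "v = 0"
proof (rule ccontr)
  assume "v \<noteq> 0"
  obtain es where es: "\<And>k. op_trace (T ^^ k) = (\<Sum>e\<leftarrow>es. e ^ k)"
    "\<And>e. e \<in> set es \<longleftrightarrow> (\<exists>v\<in>span (set bs). v \<noteq> 0 \<and> T v = e *b v)"
    by (rule op_trace_funpow_eigenvalues[OF T]) (rule that)
  have "1 \<notin> set es"
    using traces es(1) by (intro one_notin_if_power_sums_eq_0) simp
  then show False
    using es(2)[of 1] \<open>v \<noteq> 0\<close> v by auto
qed

text \<open>The trace of every \<open>A\<^sup>k R\<^sub>g\<close> with \<open>k \<ge> 1\<close> vanishes: \<open>A\<^sup>k\<^sup>+\<^sup>1 R\<^sub>g\<close> is the combination of the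
  differences \<open>A\<^sup>k R\<^sub>h\<^sub>+\<^sub>g - A\<^sup>k R\<^sub>g\<close>, and \<open>g \<mapsto> tr (A\<^sup>k R\<^sub>g)\<close> is constant, for \<open>k = 0\<close> because unipotent
  operators have the trace of the identity.\<close>

lemma unipotent_fixed_vector_eq_0:
  fixes R :: "'g::monoid_add \<Rightarrow> 'b \<Rightarrow> 'b"
  assumes R: "\<And>g. endo (R g)" and R0: "R 0 = id" and R_add: "\<And>g h. R (g + h) = R g \<circ> R h"
    and unipotent: "\<And>g v. v \<in> span (set bs) \<Longrightarrow> ((\<lambda>v. R g v - v) ^^ m) v = 0"
    and w: "w \<in> span (set bs)" "w = (\<Sum>g\<in>F. c g *b (R g w - w))"
  shows "w = 0"
proof -
  define A where "A v = (\<Sum>g\<in>F. c g *b (R g v - v))" for v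
  have endo_sub: "endo (\<lambda>v. R g v - v)" for g
    using endo_diff[OF R endo_id, of g] by simp
  have A: "endo A"
    unfolding A_def by (intro endo_sum_scale endo_sub)
  have step: "op_trace (A ^^ Suc k \<circ> R g)
      = (\<Sum>h\<in>F. c h * (op_trace (A ^^ k \<circ> R (h + g)) - op_trace (A ^^ k \<circ> R g)))" for k g
  proof -
    have AkR: "endo (A ^^ k \<circ> R h)" for h
      by (intro endo_comp endo_funpow A R)
    interpret Ak: Modules.module_hom scale scale "A ^^ k"
      using endo_funpow[OF A] by (simp add: endo_def)
    \<comment> \<open>Only the factor \<open>A\<close> next to \<open>R g\<close> is expanded;
      \<open>R_add\<close> merges its translations with \<open>R g\<close>, and the remaining
      \<open>A ^^ k\<close> is moved inside by linearity.\<close>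
    have "A ^^ Suc k \<circ> R g = (\<lambda>v. \<Sum>h\<in>F. c h *b ((A ^^ k \<circ> R (h + g)) v - (A ^^ k \<circ> R g) v))"
      unfolding funpow_Suc_right
      by (rule ext) (simp add: A_def Ak.sum Ak.scale Ak.diff R_add del: funpow.simps)
    then have "op_trace (A ^^ Suc k \<circ> R g)
        = (\<Sum>h\<in>F. c h * op_trace (\<lambda>v. (A ^^ k \<circ> R (h + g)) v - (A ^^ k \<circ> R g) v))"
      by (simp only:) (intro op_trace_sum_scale endo_diff AkR)
    then show ?thesis
      unfolding op_trace_diff[OF AkR AkR] .
  qed
  have "op_trace (R g) = op_trace id" for g
    using op_trace_nilpotent[OF endo_sub unipotent, of g] op_trace_diff[OF R endo_id, of g] by simp
  \<comment> \<open>The equality of traces for \<open>k = 0\<close> is carried through the induction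
    as a premise. At a successor both sides are \<open>0\<close>, since the induction hypothesis
    cancels every difference in \<open>step\<close>.\<close>
  then have const: "op_trace (A ^^ k \<circ> R g) = op_trace (A ^^ k \<circ> R h)" for k g h
  proof (induction k arbitrary: g h)
    case 0
    then show ?case by simp
  next
    case (Suc k)
    have "op_trace (A ^^ Suc k \<circ> R g) = 0" for g
      unfolding step
    proof (intro sum.neutral ballI)
      fix h
      show "c h * (op_trace (A ^^ k \<circ> R (h + g)) - op_trace (A ^^ k \<circ> R g)) = 0"
        by (simp only: Suc.IH[OF Suc.prems, of "h + g" g] diff_self mult_zero_right)
    qed
    then show ?case by (simp only:)
  qed
  have "op_trace (A ^^ Suc k \<circ> R 0) = 0" for k
    unfolding step
  proof (intro sum.neutral ballI)
    fix h
    show "c h * (op_trace (A ^^ k \<circ> R (h + 0)) - op_trace (A ^^ k \<circ> R 0)) = 0"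
      by (simp only: const[of k "h + 0" 0] diff_self mult_zero_right)
  qed
  then have "op_trace (A ^^ Suc k) = 0" for k
    by (simp only: R0 comp_id)
  then have "op_trace (A ^^ k) = 0" if "k \<ge> 1" for k
    using that by (metis Suc_pred' less_eq_Suc_le One_nat_def)
  moreover have "A w = w"
    using w(2) by (simp only: A_def)
  ultimately show ?thesis
    by (intro fixed_vector_eq_0[OF A _ w(1)])
qed

end

section \<open>Translations and differences of functions, and independence of iterated
  differences\<close>

lemma right_shift_add: "right_shift (g + h) = right_shift g \<circ> right_shift h"
  by (rule ext)+ (simp add: right_shift_def add.assoc)

lemma module_hom_right_shift: "Modules.module_hom cfun_scale cfun_scale (right_shift h)"
  by (simp add: Modules.module_hom_iff cfun.module_axioms right_shift_def cfun_scale_def fun_eq_iff)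

lemma module_hom_diff_op: "Modules.module_hom cfun_scale cfun_scale (diff_op h)"
  by (simp add: Modules.module_hom_iff cfun.module_axioms diff_op_def right_shift_def cfun_scale_def
      fun_eq_iff algebra_simps)

text \<open>In a noncommutative group \<open>h + g = g + (- g + h + g)\<close>, so moving a
  translation out of a difference conjugates the increment.\<close>

lemma diff_op_right_shift: "diff_op h (right_shift g f) = right_shift g (diff_op (- g + h + g) f)"
  by (rule ext) (simp add: diff_op_def right_shift_def add.assoc[symmetric])

lemma diff_op_funpow_right_shift:
  "(diff_op h ^^ k) (right_shift g f) = right_shift g ((diff_op (- g + h + g) ^^ k) f)"
  by (induction k) (simp_all add: diff_op_right_shift)

text \<open>The hypothesis covers all increments, hence also the conjugates that arise from
  translates of \<open>f\<close>; linearity extends the claim to the span. This is what makes every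
  translation unipotent there, with one exponent for all.\<close>

lemma diff_op_funpow_eq_0_on_span:
  assumes f: "\<And>h. (diff_op h ^^ k) f = 0"
    and v: "v \<in> cfun.span (range (\<lambda>g. right_shift g f))"
  shows "(diff_op h ^^ k) v = 0"
proof -
  have hom: "Modules.module_hom cfun_scale cfun_scale (diff_op h ^^ k)"
  proof (induction k)
    case 0
    show ?case by (simp add: Modules.module_hom_iff cfun.module_axioms)
  next
    case (Suc k)
    then show ?case
      by (simp add: Modules.module_hom_compose module_hom_diff_op del: comp_apply)
  qed
  then interpret hom: Modules.module_hom cfun_scale cfun_scale "diff_op h ^^ k" .
  show ?thesis
    using v
  proof (induction rule: cfun.span_induct_alt)
    case base
    show ?case by (rule hom.zero)
  next
    case (step c u v)
    then obtain g where "u = right_shift g f" by blast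
    then have "(diff_op h ^^ k) u = 0"
      by (simp add: diff_op_funpow_right_shift f) (simp add: right_shift_def fun_eq_iff)
    then show ?case by (simp only: hom.add hom.scale step.IH cfun.scale_zero_right add_0)
  qed
qed

lemma right_shift_in_span:
  assumes "v \<in> cfun.span (range (\<lambda>g. right_shift g f))"
  shows "right_shift h v \<in> cfun.span (range (\<lambda>g. right_shift g f))"
proof -
  interpret hom: Modules.module_hom cfun_scale cfun_scale "right_shift h"
    by (rule module_hom_right_shift)
  have "right_shift h ` range (\<lambda>g. right_shift g f) \<subseteq> range (\<lambda>g. right_shift g f)"
    by (auto simp: right_shift_add[THEN fun_cong, unfolded comp_apply, symmetric])
  then show ?thesis
    using assms hom.span_image[of "range (\<lambda>g. right_shift g f)"] cfun.span_mono by blast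
qed

text \<open>Expand \<open>(R\<^sub>g - 1)(R\<^sub>h - 1)\<close>: the identity terms are absorbed,
  so a composite of two differences is again a linear combination of differences.\<close>

lemma diff_op_diff_op:
  "diff_op g (diff_op h v) = diff_op (g + h) v - diff_op g v - diff_op h v"
  by (rule ext) (simp add: diff_op_def right_shift_def add.assoc)

lemma span_diff_op_subset:
  "cfun.span (range (\<lambda>g. diff_op g (diff_op h v))) \<subseteq> cfun.span (range (\<lambda>g. diff_op g v))"
  by (intro cfun.span_minimal cfun.subspace_span)
    (auto simp: diff_op_diff_op intro!: cfun.span_diff intro: cfun.span_base)

lemma unipotent_in_span_diff_op_eq_0:
  fixes f :: "'g::topological_group_add \<Rightarrow> complex"
  assumes semi: "\<And>h. (diff_op h ^^ m) f = 0"
    and B: "finite B" "cfun.independent B"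
    and V: "cfun.span (range (\<lambda>g. right_shift g f)) = cfun.span B"
    and w: "w \<in> cfun.span B" "w \<in> cfun.span (range (\<lambda>g. diff_op g w))"
  shows "w = 0"
proof -
  obtain bs where bs: "set bs = B" "distinct bs"
    using finite_distinct_list[OF B(1)] by blast
  interpret V: complex_vector_space_basis cfun_scale bs
    by unfold_locales (simp_all add: bs B)
  have diff_op_eq: "diff_op g = (\<lambda>v. right_shift g v - v)" for g :: 'g
    by (rule ext) (simp add: diff_op_def)
  obtain S r where S: "finite S" "S \<subseteq> range (\<lambda>g. diff_op g w)"
    "w = (\<Sum>a\<in>S. cfun_scale (r a) a)"
    using w(2) by (auto simp: cfun.span_explicit)
  \<comment> \<open>Different group elements may give the same difference of \<open>w\<close>; one
    representative for each function in \<open>S\<close> turns the sum over functions into a sum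
    over group elements.\<close>
  obtain F where F: "S = (\<lambda>g. diff_op g w) ` F" "inj_on (\<lambda>g. diff_op g w) F"
    using S(2) by (meson subset_image_inj)
  have "w = (\<Sum>g\<in>F. cfun_scale (r (diff_op g w)) (right_shift g w - w))"
    using S(3) unfolding F(1) sum.reindex[OF F(2)] by (simp add: diff_op_eq)
  moreover have "V.endo (right_shift g)" for g
    unfolding V.endo_def bs(1) V[symmetric]
    by (intro conjI module_hom_right_shift image_subsetI right_shift_in_span)
  moreover have "right_shift (0::'g) = id"
    by (rule ext)+ (simp add: right_shift_def)
  moreover have "((\<lambda>v. right_shift g v - v) ^^ m) v = 0" if "v \<in> cfun.span (set bs)" for g v
    using diff_op_funpow_eq_0_on_span[OF semi, of v g] that by (simp add: bs V diff_op_eq)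
  ultimately show ?thesis
    using w(1) by (intro V.unipotent_fixed_vector_eq_0[of right_shift m w _ F])
      (simp_all add: bs right_shift_add)
qed

text \<open>The first difference \<open>?w\<close> of \<open>v\<close> is nonzero, so it lies
  outside the span of its own differences. The induction hypothesis finds \<open>D\<close> inside
  that span, hence \<open>insert ?w D\<close> stays independent, and all of it lies in the span of
  the differences of \<open>v\<close>.\<close>

lemma fold_diff_op_independent:
  assumes V: "\<And>h v. v \<in> V \<Longrightarrow> diff_op h v \<in> V"
    and no_fixed: "\<And>w. w \<in> V \<Longrightarrow> w \<in> cfun.span (range (\<lambda>g. diff_op g w)) \<Longrightarrow> w = 0"
    and "v \<in> V" "fold diff_op hs v \<noteq> 0"
  shows "\<exists>D. finite D \<and> cfun.independent D \<and> D \<subseteq> cfun.span (range (\<lambda>g. diff_op g v))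
    \<and> card D = length hs"
  using assms(3,4)
proof (induction hs arbitrary: v)
  case Nil
  then show ?case by (intro exI[of _ "{}"]) (simp add: cfun.independent_empty)
next
  case (Cons h hs)
  let ?w = "diff_op h v"
  have nz: "fold diff_op hs ?w \<noteq> 0" using Cons.prems(2) by (simp only: fold.simps comp_apply not_False_eq_True)
  have "fold diff_op hs 0 = 0" for hs :: "'a list"
    by (induction hs) (simp_all add: diff_op_def right_shift_def fun_eq_iff)
  then have "?w \<noteq> 0" using nz by metis
  obtain D where D: "finite D" "cfun.independent D" "card D = length hs"
    "D \<subseteq> cfun.span (range (\<lambda>g. diff_op g ?w))"
    using Cons.IH[OF V[OF Cons.prems(1)] nz] by blast
  have "?w \<notin> cfun.span (range (\<lambda>g. diff_op g ?w))"
    using no_fixed[OF V[OF Cons.prems(1)]] \<open>?w \<noteq> 0\<close> by blast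
  then have notin: "?w \<notin> cfun.span D"
    using cfun.span_minimal[OF D(4)] by (auto simp: cfun.subspace_span)
  then have "?w \<notin> D" by (auto intro: cfun.span_base)
  then show ?case
    using D notin span_diff_op_subset[of h v]
    by (intro exI[of _ "insert ?w D"])
      (auto simp: cfun.independent_insert intro: cfun.span_base)
qed

theorem theorem3p5:
  shows "(semipolynomials :: ('g::topological_group_add \<Rightarrow> complex) set) \<inter> quasipolynomials
    \<subseteq> polynomials"
proof
  fix f :: "'g \<Rightarrow> complex"
  assume f: "f \<in> semipolynomials \<inter> quasipolynomials"
  then obtain m where cont: "continuous_on UNIV f" and semi: "\<And>h. (diff_op h ^^ m) f = 0"
    by (auto simp: semipolynomials_def semipolynomials_deg_def simp del: funpow.simps)
  let ?V = "cfun.span (range (\<lambda>g. right_shift g f))"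
  obtain B0 where B0: "finite B0" "?V = cfun.span B0"
    using f by (auto simp: quasipolynomials_def)
  \<comment> \<open>The finite spanning set may be dependent; a basis is extracted from it.\<close>
  obtain B where B: "B \<subseteq> B0" "cfun.independent B" "B0 \<subseteq> cfun.span B"
    using cfun.maximal_independent_subset[of B0] by blast
  have V: "?V = cfun.span B"
    unfolding B0(2) using B by (metis cfun.span_eq cfun.span_superset subset_trans)
  have "finite B" using B(1) B0(1) finite_subset by blast
  have diff_V: "diff_op h v \<in> ?V" if "v \<in> ?V" for h v
    using that by (simp add: diff_op_def cfun.span_diff right_shift_in_span)
  have "right_shift 0 f \<in> ?V" by (intro cfun.span_base) simp
  then have fV: "f \<in> ?V" by (simp add: right_shift_def)
  \<comment> \<open>A nonvanishing iterated difference of this length would give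
    \<open>card B + 1\<close> independent vectors in a space spanned by \<open>B\<close>. Thus
    \<open>f\<close> has degree at most \<open>card B\<close>.\<close>
  have "fold diff_op hs f = 0" if "length hs = card B + 1" for hs
  proof (rule ccontr)
    assume nz: "fold diff_op hs f \<noteq> 0"
    have no_fixed: "w = 0" if "w \<in> ?V" "w \<in> cfun.span (range (\<lambda>g. diff_op g w))" for w
      using unipotent_in_span_diff_op_eq_0[OF semi \<open>finite B\<close> B(2) V] that V by blast
    obtain D where D: "cfun.independent D" "D \<subseteq> cfun.span (range (\<lambda>g. diff_op g f))"
      "card D = length hs"
      using fold_diff_op_independent[of ?V, OF diff_V no_fixed fV nz] by blast
    have "cfun.span (range (\<lambda>g. diff_op g f)) \<subseteq> ?V"
      using diff_V[OF fV] by (intro cfun.span_minimal cfun.subspace_span) auto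
    then have "card D \<le> card B"
      using cfun.independent_span_bound[OF \<open>finite B\<close> D(1)] D(2) V by blast
    then show False using D(3) that by simp
  qed
  then show "f \<in> polynomials"
    using cont by (auto simp: polynomials_def polynomials_deg_def)
qed

end
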